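(* For all positive integers $k$ and $a$, $$\omega(k,a)\ \ge\ \frac{k\,a^{k/2}}{e}.$$
   Context: Let $\mathcal A=\{1,2,\ldots,a\}$. A submatrix of a matrix is obtained by selecting some rows and some columns (not necessarily contiguous), keeping their order. An omnimosaic $O(n,k,a)$ is an $n\times n$ matrix with entries in $\mathcal A$ that contains, as a submatrix, each of the $a^{k^2}$ $k\times k$ matrices over $\mathcal A$. For positive integers $k,a$, $\omega(k,a)$ denotes the smallest $n$ for which an $O(n,k,a)$ omnimosaic exists. Here $e$ is the base of the natural logarithm. *)

theory Defs
  imports Complex_Main "Jordan_Normal_Form.DL_Submatrix"
begin

definition alphabet_mat :: "nat \<Rightarrow> nat \<Rightarrow> nat \<Rightarrow> nat mat set" where
  "alphabet_mat m n a = {A \<in> carrier_mat m n. elements_mat A \<subseteq> {1..a}}"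

definition omnimosaic :: "nat \<Rightarrow> nat \<Rightarrow> nat \<Rightarrow> nat mat \<Rightarrow> bool" where
  "omnimosaic n k a A \<longleftrightarrow>
     A \<in> alphabet_mat n n a \<and>
     (\<forall>B \<in> alphabet_mat k k a. \<exists>I \<subseteq> {..<n}. \<exists>J \<subseteq> {..<n}. submatrix A I J = B)"

(* For positive k and a some omnimosaic exists (put all k x k matrices as blocks along the
   diagonal), so the minimum is attained. *)
definition omega :: "nat \<Rightarrow> nat \<Rightarrow> nat" where
  "omega k a = (LEAST n. \<exists>A. omnimosaic n k a A)"

end

theory Submission
  imports Defs
begin

text \<open>
  The bound is a counting argument. A \<open>k \<times> k\<close> submatrix of an \<open>n \<times> n\<close> matrix is determined by
  the \<open>k\<close> rows and the \<open>k\<close> columns that it keeps, so at most \<open>(n choose k)\<^sup>2\<close> different ones occur,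
  while an omnimosaic must show all \<open>a ^ (k * k)\<close> of them (lemma \<open>omnimosaic_count\<close>). Taking
  \<open>k\<close>-th roots after \<open>n choose k \<le> n ^ k / fact k \<le> (e * n / k) ^ k\<close> (lemma \<open>choose_le_power\<close>)
  leaves \<open>a ^ k \<le> (e * n / k)\<^sup>2\<close>, which is the claim for the size \<open>n\<close> of any omnimosaic.

  The number \<open>omega k a\<close> is a \<open>LEAST\<close>, about which nothing is known unless the predicate is
  satisfiable. The proof therefore also has to exhibit one omnimosaic (lemma \<open>omnimosaic_exists\<close>).
\<close>

section \<open>Contiguous submatrices and the number of matrices\<close>

lemma pick_interval:
  assumes "i < k"
  shows "pick {c..<c + k} i = c + i"
proof -
  have "{x \<in> {c..<c + k}. x < c + i} = {c..<c + i}"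
    using assms by auto
  then show ?thesis
    using pick_card_in_set[of "c + i" "{c..<c + k}"] assms by simp
qed

lemma submatrix_block:
  assumes "r + p \<le> dim_row A" "c + q \<le> dim_col A"
  shows "submatrix A {r..<r + p} {c..<c + q} = mat p q (\<lambda>(i, j). A $$ (r + i, c + j))"
proof -
  have "{i. i < dim_row A \<and> i \<in> {r..<r + p}} = {r..<r + p}"
    "{j. j < dim_col A \<and> j \<in> {c..<c + q}} = {c..<c + q}"
    using assms by auto
  then show ?thesis
    unfolding submatrix_def by (intro eq_matI) (simp_all add: pick_interval)
qed

lemma alphabet_mat_iff:
  "A \<in> alphabet_mat m n a \<longleftrightarrow>
     A \<in> carrier_mat m n \<and> (\<forall>i<m. \<forall>j<n. A $$ (i, j) \<in> {1..a})"
  (is "_ \<longleftrightarrow> ?R")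
proof
  assume A: "A \<in> alphabet_mat m n a"
  then have "A $$ (i, j) \<in> {1..a}" if "i < m" "j < n" for i j
    using that elements_matI[of A m n i j] by (simp add: alphabet_mat_def subset_iff)
  then show ?R
    using A by (simp add: alphabet_mat_def)
next
  assume A: ?R
  have "x \<in> {1..a}" if x: "x \<in> elements_mat A" for x
  proof -
    obtain i j where "i < dim_row A" "j < dim_col A" "x = A $$ (i, j)"
      using elements_matD[OF x] by blast
    then show ?thesis
      using A by auto
  qed
  then show "A \<in> alphabet_mat m n a"
    using A by (simp add: alphabet_mat_def subset_iff)
qed

lemma bij_betw_mat_alphabet_mat:
  "bij_betw (mat m n) (({..<m} \<times> {..<n}) \<rightarrow>\<^sub>E {1..a}) (alphabet_mat m n a)"
proof (rule bij_betw_byWitness[where f' = "\<lambda>A. restrict (($$) A) ({..<m} \<times> {..<n})"])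
  show "\<forall>f\<in>({..<m} \<times> {..<n}) \<rightarrow>\<^sub>E {1..a}. restrict (($$) (mat m n f)) ({..<m} \<times> {..<n}) = f"
  proof (intro ballI extensionalityI)
    fix f assume "f \<in> ({..<m} \<times> {..<n}) \<rightarrow>\<^sub>E {1..a}"
    then show "f \<in> extensional ({..<m} \<times> {..<n})"
      by (simp add: PiE_def)
  qed auto
  show "\<forall>A\<in>alphabet_mat m n a. mat m n (restrict (($$) A) ({..<m} \<times> {..<n})) = A"
  proof
    fix A assume "A \<in> alphabet_mat m n a"
    then have "dim_row A = m" "dim_col A = n"
      by (auto simp: alphabet_mat_iff)
    then show "mat m n (restrict (($$) A) ({..<m} \<times> {..<n})) = A"
      by (intro eq_matI) simp_all
  qed
  show "mat m n ` (({..<m} \<times> {..<n}) \<rightarrow>\<^sub>E {1..a}) \<subseteq> alphabet_mat m n a"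
  proof (rule image_subsetI)
    fix f assume f: "f \<in> ({..<m} \<times> {..<n}) \<rightarrow>\<^sub>E {1..a}"
    have "f (i, j) \<in> {1..a}" if "i < m" "j < n" for i j
      by (rule PiE_mem[OF f]) (use that in simp)
    then show "mat m n f \<in> alphabet_mat m n a"
      by (simp add: alphabet_mat_iff)
  qed
  show "(\<lambda>A. restrict (($$) A) ({..<m} \<times> {..<n})) ` alphabet_mat m n a
      \<subseteq> ({..<m} \<times> {..<n}) \<rightarrow>\<^sub>E {1..a}"
  proof (rule image_subsetI)
    fix A assume A: "A \<in> alphabet_mat m n a"
    show "restrict (($$) A) ({..<m} \<times> {..<n}) \<in> ({..<m} \<times> {..<n}) \<rightarrow>\<^sub>E {1..a}"
    proof (rule restrict_PiE_iff[THEN iffD2], rule ballI)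
      fix p assume "p \<in> {..<m} \<times> {..<n}"
      then show "A $$ p \<in> {1..a}"
        using A by (cases p) (simp add: alphabet_mat_iff)
    qed
  qed
qed

lemma finite_alphabet_mat: "finite (alphabet_mat m n a)"
  using bij_betw_finite[OF bij_betw_mat_alphabet_mat, of m n a] by (simp add: finite_PiE)

lemma card_alphabet_mat: "card (alphabet_mat m n a) = a ^ (m * n)"
  using bij_betw_same_card[OF bij_betw_mat_alphabet_mat, of m n a] by (simp add: card_PiE)

section \<open>Existence of omnimosaics\<close>

text \<open>
  Stack all \<open>k \<times> k\<close> matrices on top of each other and repeat the resulting strip to the right
  until the matrix is square. Every target then occurs as a contiguous block in the first
  \<open>k\<close> columns. Repeating the strip, rather than placing the blocks along the diagonal, leaves no
  entries to be filled in with arbitrary letters.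
\<close>
lemma omnimosaic_exists:
  assumes "k > 0"
  shows "\<exists>n A. omnimosaic n k a A"
proof -
  obtain Bs where Bs: "set Bs = alphabet_mat k k a"
    using finite_list[OF finite_alphabet_mat] by blast
  define n where "n = length Bs * k"
  define A where "A = mat n n (\<lambda>(i, j). (Bs ! (i div k)) $$ (i mod k, j mod k))"
  have "A \<in> alphabet_mat n n a"
  proof -
    have "(Bs ! (i div k)) $$ (i mod k, j mod k) \<in> {1..a}" if "i < n" for i j
    proof -
      have "i div k < length Bs"
        using that assms by (simp add: n_def less_mult_imp_div_less)
      then have "Bs ! (i div k) \<in> alphabet_mat k k a"
        using Bs nth_mem by blast
      then show ?thesis
        using assms by (simp add: alphabet_mat_iff)
    qed
    then show ?thesis
      by (auto simp: alphabet_mat_iff A_def)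
  qed
  moreover have "\<exists>I\<subseteq>{..<n}. \<exists>J\<subseteq>{..<n}. submatrix A I J = B"
    if B: "B \<in> alphabet_mat k k a" for B
  proof -
    obtain s where s: "s < length Bs" "Bs ! s = B"
      using B Bs by (metis in_set_conv_nth)
    have "Suc s * k \<le> length Bs * k"
      using s(1) by (intro mult_le_mono1) simp
    then have le: "s * k + k \<le> n"
      by (simp add: n_def)
    have "submatrix A {s * k..<s * k + k} {0..<0 + k} = B"
      using B le s(2) by (subst submatrix_block) (auto simp: A_def alphabet_mat_iff)
    moreover have "{s * k..<s * k + k} \<subseteq> {..<n}" "{0..<0 + k} \<subseteq> {..<n}"
      using le by auto
    ultimately show ?thesis
      by blast
  qed
  ultimately have "omnimosaic n k a A"
    unfolding omnimosaic_def by simp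
  then show ?thesis
    by (intro exI)
qed

section \<open>Counting submatrices\<close>

text \<open>
  The index sets \<open>I\<close> and \<open>J\<close> in the definition of an omnimosaic are arbitrary subsets of
  \<open>{..<n}\<close>, but the dimensions of \<open>submatrix A I J\<close> are their cardinalities, so only those with
  \<open>k\<close> elements can produce a \<open>k \<times> k\<close> matrix.
\<close>
lemma omnimosaic_count:
  assumes "omnimosaic n k a A"
  shows "a ^ (k * k) \<le> (n choose k)\<^sup>2"
proof -
  define S where "S = {I. I \<subseteq> {..<n} \<and> card I = k}"
  have S: "finite S" "card S = n choose k"
    using n_subsets[of "{..<n}" k] by (auto simp: S_def)
  have A: "A \<in> carrier_mat n n"
    using assms by (simp add: omnimosaic_def alphabet_mat_iff)
  have "alphabet_mat k k a \<subseteq> (\<lambda>(I, J). submatrix A I J) ` (S \<times> S)"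
  proof
    fix B assume B: "B \<in> alphabet_mat k k a"
    then obtain I J where IJ: "I \<subseteq> {..<n}" "J \<subseteq> {..<n}" "submatrix A I J = B"
      using assms unfolding omnimosaic_def by blast
    have "{i. i < n \<and> i \<in> I} = I" "{j. j < n \<and> j \<in> J} = J"
      using IJ(1,2) by auto
    moreover have "dim_row A = n" "dim_col A = n" "dim_row B = k" "dim_col B = k"
      using A B by (auto simp: alphabet_mat_iff)
    ultimately have "card I = k" "card J = k"
      using dim_submatrix[of A I J] unfolding IJ(3) by metis+
    then show "B \<in> (\<lambda>(I, J). submatrix A I J) ` (S \<times> S)"
      using IJ by (auto simp: S_def)
  qed
  then have "card (alphabet_mat k k a) \<le> card (S \<times> S)"
    using S by (intro surj_card_le) auto
  then show ?thesis
    by (simp add: card_alphabet_mat S card_cartesian_product power2_eq_square)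
qed

section \<open>From the count to the bound\<close>

text \<open>The left side is a single term of the exponential series, all of whose terms are nonnegative.\<close>
lemma power_div_fact_le_exp:
  assumes "x \<ge> 0"
  shows "x ^ k / fact k \<le> exp (x :: real)"
proof -
  have "(\<Sum>n\<in>{k}. x ^ n /\<^sub>R fact n) \<le> exp x"
    unfolding exp_def using assms by (intro sum_le_suminf summable_exp_generic) auto
  then show ?thesis
    by (simp add: field_simps)
qed

text \<open>
  The series estimate at \<open>x = k\<close> replaces Stirling's formula: it gives \<open>fact k \<ge> (k / e) ^ k\<close>.
\<close>
lemma choose_le_power:
  assumes "k > 0"
  shows "real (n choose k) \<le> (real n * exp 1 / real k) ^ k"
proof -
  have "real k ^ k / fact k \<le> exp 1 ^ k"
    using power_div_fact_le_exp[of "real k" k] exp_of_nat_mult[of k "1 :: real"] by simp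
  then have "1 / fact k \<le> (exp 1 / real k) ^ k"
    using assms by (simp add: field_simps power_divide)
  have "real ((n choose k) * fact k) \<le> real (n ^ k)"
    using binomial_fact_pow[of n k] by (simp only: of_nat_le_iff)
  then have "real (n choose k) \<le> real n ^ k * (1 / fact k)"
    by (simp add: field_simps)
  also have "\<dots> \<le> real n ^ k * (exp 1 / real k) ^ k"
    by (intro mult_left_mono) (use \<open>1 / fact k \<le> _\<close> in auto)
  finally show ?thesis
    by (simp add: power_mult_distrib power_divide)
qed

lemma omnimosaic_size_ge:
  assumes "omnimosaic n k a A" "k > 0"
  shows "real n \<ge> real k * real a powr (real k / 2) / exp 1"
proof -
  \<comment> \<open>chosen so that the claim reads \<open>a powr (k / 2) \<le> x\<close>\<close>
  define x where "x = real n * exp 1 / real k"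
  have "x \<ge> 0"
    by (simp add: x_def)
  have "(real a ^ k) ^ k \<le> (real (n choose k))\<^sup>2"
    using omnimosaic_count[OF assms(1)]
    by (simp only: of_nat_power[symmetric] power_mult[symmetric] of_nat_le_iff)
  also have "\<dots> \<le> (x ^ k)\<^sup>2"
    using choose_le_power[OF assms(2), of n] by (intro power_mono) (auto simp: x_def)
  finally have "(real a ^ k) ^ k \<le> (x\<^sup>2) ^ k"
    by (simp only: power_mult[symmetric] mult.commute[of k 2])
  then have "real a ^ k \<le> x\<^sup>2"
    using assms(2) by (subst (asm) power_mono_iff) simp_all
  moreover have "(real a powr (real k / 2))\<^sup>2 = real a ^ k"
  proof (cases "a = 0")
    case False
    have "(real a powr (real k / 2))\<^sup>2 = real a powr real k"
      by (simp add: power2_eq_square flip: powr_add)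
    then show ?thesis
      using False by (simp add: powr_realpow)
  qed (use assms(2) in simp)
  ultimately have "real a powr (real k / 2) \<le> x"
    using \<open>x \<ge> 0\<close> by (metis power2_le_imp_le)
  then show ?thesis
    using assms(2) by (simp add: x_def field_simps)
qed

theorem mainTheorem2:
  fixes k a :: nat
  assumes "k > 0" and "a > 0"
  shows "real (omega k a) \<ge> real k * real a powr (real k / 2) / exp 1"
proof -
  have "\<exists>A. omnimosaic (omega k a) k a A"
    unfolding omega_def using omnimosaic_exists[OF assms(1)] by (rule LeastI_ex)
  then show ?thesis
    using omnimosaic_size_ge assms(1) by blast
qed

end
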